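(* For any function $g$ lying in $\mathcal{C}^0\cap\mathrm{dom}(\Sigma)$, we have $$\int_x^{x+1}\Sigma g(t)\,dt=\sigma[g]+\int_1^xg(t)\,dt,\qquad x>0,$$ where $\sigma[g]$ is the asymptotic constant associated with $g$, defined by $\sigma[g]=\int_0^1\Sigma g(t+1)\,dt$.
   Context: $\mathbb{R}_+=(0,\infty)$, $\Delta f(x)=f(x+1)-f(x)$; $\mathcal{C}^0$ is the set of continuous functions $\mathbb{R}_+\to\mathbb{R}$. For an integer $p\ge -1$, a function $f\colon I\to\mathbb{R}$ on a real interval $I$ is $p$-convex (resp. $p$-concave) if for all $x_0<\cdots<x_{p+1}$ in $I$ the divided difference $f[x_0,\ldots,x_{p+1}]$ is $\ge 0$ (resp. $\le 0$), where $f[x_0,\ldots,x_n]=\sum_{k=0}^n f(x_k)/\prod_{j\ne k}(x_k-x_j)$. $\mathcal{K}^p$ is the set of functions $\mathbb{R}_+\to\mathbb{R}$ that are $p$-convex on some $[a,\infty)$ or $p$-concave on some $[a,\infty)$. $\mathcal{D}^p$ is the set of $g\colon\mathbb{R}_+\to\mathbb{R}$ with $\Delta^pg(n)\to 0$ as $n\to\infty$ over the integers. $\mathrm{dom}(\Sigma)=\bigcup_{p\ge0}(\mathcal{D}^p\cap\mathcal{K}^p)$. For $g\in\mathcal{D}^p\cap\mathcal{K}^p$, the function $\Sigma g\colon\mathbb{R}_+\to\mathbb{R}$ is $$\Sigma g(x)=\lim_{n\to\infty}\Big(-g(x)+\sum_{k=1}^{n-1}(g(k)-g(x+k))+\sum_{j=1}^p\binom{x}{j}\Delta^{j-1}g(n)\Big);$$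 the limit exists, does not depend on the choice of such $p$, and $\Sigma g$ is the unique solution $f\in\mathcal{K}^p$ of $\Delta f=g$ with $f(1)=0$; it is continuous if $g$ is. *)

theory Defs
  imports "HOL-Analysis.Analysis"
begin

text \<open>
  Functions on the open half-line of positive reals are represented by total functions
  on the reals; every notion below depends only on their values at positive arguments.
\<close>

definition C0 :: "(real \<Rightarrow> real) set" where
  "C0 = {f. continuous_on {0<..} f}"

definition fdiff :: "(real \<Rightarrow> real) \<Rightarrow> real \<Rightarrow> real" where
  "fdiff f x = f (x + 1) - f x"

text \<open>The divided difference of \<open>f\<close> at the \<open>n + 1\<close> points \<open>x 0, \<dots>, x n\<close>.\<close>

definition divided_difference :: "(real \<Rightarrow> real) \<Rightarrow> (nat \<Rightarrow> real) \<Rightarrow> nat \<Rightarrow> real" where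
  "divided_difference f x n = (\<Sum>k\<le>n. f (x k) / (\<Prod>j\<in>{..n} - {k}. x k - x j))"

text \<open>The order \<open>p\<close> is an integer with \<open>p \<ge> -1\<close>, so \<open>nat (p + 1)\<close> does not truncate.\<close>

definition p_convex_on :: "int \<Rightarrow> real set \<Rightarrow> (real \<Rightarrow> real) \<Rightarrow> bool" where
  "p_convex_on p I f \<longleftrightarrow>
     (\<forall>x. x ` {..nat (p + 1)} \<subseteq> I \<and> strict_mono_on {..nat (p + 1)} x
        \<longrightarrow> divided_difference f x (nat (p + 1)) \<ge> 0)"

definition p_concave_on :: "int \<Rightarrow> real set \<Rightarrow> (real \<Rightarrow> real) \<Rightarrow> bool" where
  "p_concave_on p I f \<longleftrightarrow>
     (\<forall>x. x ` {..nat (p + 1)} \<subseteq> I \<and> strict_mono_on {..nat (p + 1)} x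
        \<longrightarrow> divided_difference f x (nat (p + 1)) \<le> 0)"

definition Kp :: "int \<Rightarrow> (real \<Rightarrow> real) set" where
  "Kp p = {f. (\<exists>a>0. p_convex_on p {a..} f) \<or> (\<exists>a>0. p_concave_on p {a..} f)}"

definition Dp :: "nat \<Rightarrow> (real \<Rightarrow> real) set" where
  "Dp p = {g. (\<lambda>n. (fdiff ^^ p) g (real n)) \<longlonglongrightarrow> 0}"

definition dom_Sigma :: "(real \<Rightarrow> real) set" where
  "dom_Sigma = (\<Union>p. Dp p \<inter> Kp (int p))"

definition Sigma_seq :: "nat \<Rightarrow> (real \<Rightarrow> real) \<Rightarrow> real \<Rightarrow> nat \<Rightarrow> real" where
  "Sigma_seq p g x n =
     - g x + (\<Sum>k=1..<n. g (real k) - g (x + real k))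
     + (\<Sum>j=1..p. (x gchoose j) * (fdiff ^^ (j - 1)) g (real n))"

text \<open>
  For \<open>g\<close> in \<open>dom_Sigma\<close> and \<open>x > 0\<close>, the common limit of the sequences
  \<open>Sigma_seq p g x\<close> over all admissible orders \<open>p\<close>; the value is unspecified otherwise.
\<close>

definition Sigma_op :: "(real \<Rightarrow> real) \<Rightarrow> real \<Rightarrow> real" where
  "Sigma_op g x = (THE L. \<forall>p. g \<in> Dp p \<inter> Kp (int p) \<longrightarrow> Sigma_seq p g x \<longlonglongrightarrow> L)"

definition asymptotic_constant :: "(real \<Rightarrow> real) \<Rightarrow> real" where
  "asymptotic_constant g = (LBINT t=0..1. Sigma_op g (t + 1))"

end

theory Submission
  imports Defs
begin

text \<open>
  Write \<open>S\<close> for \<open>\<Sigma>g\<close>. The identity says that \<open>x \<mapsto> \<integral>\<^sub>x\<^sup>x\<^sup>+\<^sup>1 S\<close> is the antiderivative of \<open>g\<close> whose value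
  at \<open>1\<close> is \<open>\<sigma>[g] = \<integral>\<^sub>1\<^sup>2 S\<close>. If \<open>P\<close> is an antiderivative of \<open>S\<close> on the positive half-line, then
  \<open>P(x + 1) - P(x)\<close> has derivative \<open>S(x + 1) - S(x) = g(x)\<close>, and the fundamental theorem of
  calculus gives the claim. What this uses is that \<open>S\<close> is continuous
  (\<open>continuous_on_Sigma_op\<close>) and satisfies \<open>\<Delta>S = g\<close> (\<open>Sigma_op_difference_equation\<close>); since \<open>S\<close> is
  defined as a limit, both come down to controlling the convergence of \<open>Sigma_seq\<close>.

  That control comes from Newton interpolation. The increment of \<open>Sigma_seq p g x\<close> from \<open>n\<close> to
  \<open>n + 1\<close> is, up to sign, the error at \<open>n + x\<close> of the polynomial interpolating \<open>g\<close> at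
  \<open>n, \<dots>, n + p\<close>, and the defect of \<open>Sigma_seq p g\<close> in the difference equation is the error of the
  interpolation at \<open>n, \<dots>, n + p - 1\<close>. Both errors are expressed by divided differences of \<open>g\<close> at
  \<open>p + 1\<close> points. For \<open>p\<close>-convex \<open>g\<close> these grow when nodes move to the right
  (\<open>divdiff_mono_nodes\<close>), so they lie between \<open>d(n - 1)\<close> and \<open>d(n + L)\<close>, where \<open>d(z)\<close>, the divided
  difference at \<open>z, z + 1, \<dots>, z + p\<close>, equals \<open>\<Delta>\<^sup>pg(z) / p!\<close> and tends to \<open>0\<close> along the integers
  (\<open>newton_remainder_bounds\<close>). The differences \<open>d(n + L) - d(n - 1)\<close> telescope, hence are summable,
  and the Weierstrass test makes \<open>Sigma_seq\<close> converge uniformly for \<open>0 < x < L\<close>. The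
  \<open>p\<close>-concave case follows by negating \<open>g\<close>.
\<close>

section \<open>Divided differences over finite sets of nodes\<close>

text \<open>
  The divided difference is symmetric in its nodes, so it may be indexed by the finite set of
  nodes; exchanging or adding a node then needs no reordering.
\<close>

definition divdiff :: "(real \<Rightarrow> real) \<Rightarrow> real set \<Rightarrow> real" where
  "divdiff f S = (\<Sum>x\<in>S. f x / (\<Prod>y\<in>S - {x}. x - y))"

lemma divided_difference_eq_divdiff:
  assumes "inj_on x {..n}"
  shows "divided_difference f x n = divdiff f (x ` {..n})"
proof -
  have *: "(\<Prod>y\<in>x ` {..n} - {x k}. x k - y) = (\<Prod>j\<in>{..n} - {k}. x k - x j)"
    if "k \<le> n" for k
  proof -
    have "x ` {..n} - {x k} = x ` ({..n} - {k})"
      using assms that by (auto simp: inj_on_def)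
    moreover have "inj_on x ({..n} - {k})"
      using assms by (auto simp: inj_on_def)
    ultimately show ?thesis
      by (simp add: prod.reindex)
  qed
  show ?thesis
    unfolding divided_difference_def divdiff_def
    by (subst sum.reindex[OF assms]) (auto simp: * intro!: sum.cong)
qed

lemma divdiff_singleton [simp]: "divdiff f {y} = f y"
  by (simp add: divdiff_def)

text \<open>
  The usual recursion for divided differences. It holds term by term: for a common node \<open>x\<close> it is
  \<open>1 / (x - u) - 1 / (x - v) = (u - v) / ((x - u) (x - v))\<close>.
\<close>

lemma divdiff_exchange:
  assumes "finite T" "u \<notin> T" "v \<notin> T" "u \<noteq> v"
  shows "divdiff f (insert u T) - divdiff f (insert v T)
           = (u - v) * divdiff f (insert u (insert v T))"
proof -
  have one: "divdiff f (insert w T) =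
      f w / (\<Prod>y\<in>T. w - y) + (\<Sum>x\<in>T. f x / ((x - w) * (\<Prod>y\<in>T - {x}. x - y)))"
    if "w \<notin> T" for w
  proof -
    have "insert w T - {x} = insert w (T - {x})" if "x \<in> T" for x
      using that \<open>w \<notin> T\<close> by auto
    then show ?thesis
      using assms(1) that by (simp add: divdiff_def)
  qed
  have two: "divdiff f (insert u (insert v T)) =
      f u / ((u - v) * (\<Prod>y\<in>T. u - y)) + f v / ((v - u) * (\<Prod>y\<in>T. v - y))
      + (\<Sum>x\<in>T. f x / ((x - u) * ((x - v) * (\<Prod>y\<in>T - {x}. x - y))))"
  proof -
    have "insert u (insert v T) - {x} = insert u (insert v (T - {x}))" if "x \<in> T" for x
      using that assms by auto
    moreover have "insert u (insert v T) - {u} = insert v T"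
      "insert u (insert v T) - {v} = insert u T"
      using assms by auto
    ultimately show ?thesis
      using assms by (simp add: divdiff_def)
  qed
  have termwise: "f x / ((x - u) * q) - f x / ((x - v) * q)
      = (u - v) * (f x / ((x - u) * ((x - v) * q)))" if "x \<in> T" for x q
  proof -
    have "x - u \<noteq> 0" "x - v \<noteq> 0"
      using that assms by auto
    then have "f x / (x - u) - f x / (x - v) = (u - v) * (f x / ((x - u) * (x - v)))"
      by (simp add: field_simps)
    then have "(f x / (x - u) - f x / (x - v)) / q = (u - v) * (f x / ((x - u) * (x - v))) / q"
      by simp
    then show ?thesis
      by (simp add: diff_divide_distrib mult.assoc)
  qed
  have "(\<Sum>x\<in>T. f x / ((x - u) * (\<Prod>y\<in>T - {x}. x - y)))
      - (\<Sum>x\<in>T. f x / ((x - v) * (\<Prod>y\<in>T - {x}. x - y)))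
      = (u - v) * (\<Sum>x\<in>T. f x / ((x - u) * ((x - v) * (\<Prod>y\<in>T - {x}. x - y))))"
    by (simp add: sum_subtractf[symmetric] sum_distrib_left termwise)
  moreover have "(u - v) * (f u / ((u - v) * q)) = f u / q" for q
    using assms by simp
  moreover have "(u - v) * (f v / ((v - u) * q)) = - (f v / q)" for q
    using assms by (cases "q = 0") (simp_all add: field_simps)
  ultimately show ?thesis
    by (simp add: one two assms distrib_left)
qed

lemma p_convex_on_divdiff_nonneg:
  assumes "p_convex_on (int p) I f" "S \<subseteq> I" "card S = p + 2"
  shows "0 \<le> divdiff f S"
proof -
  have "finite S"
    using assms(3) card.infinite by fastforce
  define h where "h = (\<lambda>i. sorted_list_of_set S ! i)"
  have len: "length (sorted_list_of_set S) = p + 2"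
    by (simp add: assms(3))
  have "h ` {..<p + 2} = S"
    using nth_image[of "p + 2" "sorted_list_of_set S"] \<open>finite S\<close> len
    by (simp add: h_def lessThan_atLeast0)
  moreover have mono: "strict_mono_on {..<p + 2} h"
    unfolding h_def strict_mono_on_def
    using len sorted_wrt_nth_less[OF strict_sorted_list_of_set[of S]] by simp
  moreover have [simp]: "{..<p + 2} = {..p + 1}" and [simp]: "nat (int p + 1) = p + 1"
    by auto
  ultimately have "h ` {..p + 1} = S" "strict_mono_on {..p + 1} h"
    by simp_all
  moreover have "0 \<le> divided_difference f h (p + 1)"
    using assms(1,2) calculation unfolding p_convex_on_def by auto
  ultimately show ?thesis
    using divided_difference_eq_divdiff strict_mono_on_imp_inj_on by metis
qed

text \<open>
  By \<open>divdiff_exchange\<close>, replacing one node by a larger one changes a divided difference by a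
  positive multiple of one with \<open>p + 2\<close> nodes, which is nonnegative. Replacing the nodes of \<open>A\<close> by
  those of \<open>B\<close> one at a time proves the claim; the common part \<open>C\<close> absorbs the nodes that have
  already been moved.
\<close>

lemma divdiff_mono_nodes:
  assumes conv: "\<And>S. S \<subseteq> I \<Longrightarrow> card S = p + 2 \<Longrightarrow> 0 \<le> divdiff f S"
    and "finite A" "finite B" "finite C" "card A = card B" "card (A \<union> C) = p + 1"
    and "A \<inter> C = {}" "B \<inter> C = {}" "A \<union> B \<union> C \<subseteq> I" "\<forall>a\<in>A. \<forall>b\<in>B. a < b"
  shows "divdiff f (A \<union> C) \<le> divdiff f (B \<union> C)"
  using assms(2-)
proof (induction A arbitrary: B C rule: finite_induct)
  case empty
  then show ?case by simp
next
  case (insert a A)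
  obtain b where "b \<in> B"
    using insert by fastforce
  define B' where "B' = B - {b}"
  have B: "B = insert b B'" "b \<notin> B'" "finite B'"
    using \<open>b \<in> B\<close> insert.prems by (auto simp: B'_def)
  have b: "b \<notin> A \<union> C" and ab: "a < b" and a: "a \<notin> A \<union> C"
    using insert B by auto
  have card_AC: "card (A \<union> C) = p"
    using insert.prems insert.hyps a by simp
  have "0 \<le> divdiff f (insert b (insert a (A \<union> C)))"
    by (rule conv) (use insert B b a ab card_AC in auto)
  then have "divdiff f (insert a (A \<union> C)) \<le> divdiff f (insert b (A \<union> C))"
    using divdiff_exchange[of "A \<union> C" b a f] a b ab insert.hyps insert.prems
    by (smt (verit) mult_nonneg_nonneg finite_UnI)
  also have "insert b (A \<union> C) = A \<union> insert b C"
    by auto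
  also have "divdiff f (A \<union> insert b C) \<le> divdiff f (B' \<union> insert b C)"
    using insert.prems insert.hyps B b card_AC
    by (intro insert.IH) auto
  also have "B' \<union> insert b C = B \<union> C"
    using B by auto
  finally show ?case
    by simp
qed

section \<open>Newton interpolation at equally spaced nodes\<close>

definition unit_nodes :: "real \<Rightarrow> nat \<Rightarrow> real set" where
  "unit_nodes y n = (\<lambda>i. y + real i) ` {..<n}"

lemma unit_nodes_0 [simp]: "unit_nodes y 0 = {}"
  by (simp add: unit_nodes_def)

lemma finite_unit_nodes [simp]: "finite (unit_nodes y n)"
  by (simp add: unit_nodes_def)

lemma card_unit_nodes [simp]: "card (unit_nodes y n) = n"
  by (simp add: unit_nodes_def card_image inj_on_def)

lemma unit_nodes_Suc: "unit_nodes y (Suc n) = insert (y + real n) (unit_nodes y n)"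
  by (simp add: unit_nodes_def lessThan_Suc)

lemma unit_nodes_Suc_shift: "unit_nodes y (Suc n) = insert y (unit_nodes (y + 1) n)"
  unfolding unit_nodes_def lessThan_Suc_eq_insert_0 by (force simp: image_image)

lemma unit_nodes_bounds: "z \<in> unit_nodes y n \<Longrightarrow> y \<le> z \<and> z \<le> y + real n - 1"
  by (auto simp: unit_nodes_def)

lemma fdiff_power_Suc: "(fdiff ^^ Suc j) f y = (fdiff ^^ j) f (y + 1) - (fdiff ^^ j) f y"
  by (simp add: fdiff_def[of "(fdiff ^^ j) f"])

lemma fdiff_power_eq_divdiff:
  "(fdiff ^^ p) f y = fact p * divdiff f (unit_nodes y (Suc p))"
proof (induction p arbitrary: y)
  case 0
  then show ?case by (simp add: unit_nodes_Suc)
next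
  case (Suc p)
  let ?T = "unit_nodes (y + 1) p"
  have eqs: "unit_nodes (y + 1) (Suc p) = insert (y + 1 + real p) ?T"
    "unit_nodes y (Suc p) = insert y ?T"
    "unit_nodes y (Suc (Suc p)) = insert (y + 1 + real p) (insert y ?T)"
    using unit_nodes_Suc unit_nodes_Suc_shift by (auto simp: insert_commute)
  have "y + 1 + real p \<notin> ?T" "y \<notin> ?T"
    by (auto dest: unit_nodes_bounds)
  then have "divdiff f (unit_nodes (y + 1) (Suc p)) - divdiff f (unit_nodes y (Suc p))
      = (1 + real p) * divdiff f (unit_nodes y (Suc (Suc p)))"
    unfolding eqs by (subst divdiff_exchange) auto
  moreover have "(fdiff ^^ Suc p) f y
      = fact p * (divdiff f (unit_nodes (y + 1) (Suc p)) - divdiff f (unit_nodes y (Suc p)))"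
    unfolding fdiff_power_Suc Suc.IH by (simp add: right_diff_distrib)
  ultimately show ?case
    by (simp add: algebra_simps)
qed

text \<open>
  The error at \<open>y + x\<close> of the polynomial of degree less than \<open>p\<close> that agrees with \<open>f\<close> at
  \<open>y, y + 1, \<dots>, y + p - 1\<close>, in Newton's forward form.
\<close>

definition newton_remainder :: "nat \<Rightarrow> (real \<Rightarrow> real) \<Rightarrow> real \<Rightarrow> real \<Rightarrow> real" where
  "newton_remainder p f y x = f (y + x) - (\<Sum>j<p. (x gchoose j) * (fdiff ^^ j) f y)"

lemma gchoose_times_fdiff_power:
  "(x gchoose p) * (fdiff ^^ p) f y
     = (\<Prod>i<p. x - real i) * divdiff f (unit_nodes y (Suc p))"
  by (simp add: fdiff_power_eq_divdiff gbinomial_prod_rev atLeast0LessThan)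

lemma newton_remainder_Suc:
  "newton_remainder (Suc p) f y x = newton_remainder p f y x
     - (\<Prod>i<p. x - real i) * divdiff f (unit_nodes y (Suc p))"
  by (simp add: newton_remainder_def gchoose_times_fdiff_power)

text \<open>
  Raising \<open>p\<close> subtracts from the divided difference the same one with \<open>y + x\<close> replaced by \<open>y + p\<close>,
  and \<open>divdiff_exchange\<close> turns the difference into the missing factor \<open>x - p\<close>. The excluded
  values of \<open>x\<close> are those for which \<open>y + x\<close> is already a node.
\<close>

lemma newton_remainder_eq_divdiff:
  assumes "\<And>i. i < p \<Longrightarrow> x \<noteq> real i"
  shows "newton_remainder p f y x
           = (\<Prod>i<p. x - real i) * divdiff f (insert (y + x) (unit_nodes y p))"
  using assms
proof (induction p)
  case 0
  then show ?case by (simp add: newton_remainder_def)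
next
  case (Suc p)
  have "y + x \<notin> unit_nodes y p" "y + real p \<notin> unit_nodes y p"
    using Suc.prems by (auto simp: unit_nodes_def)
  then have "divdiff f (insert (y + x) (unit_nodes y p)) - divdiff f (unit_nodes y (Suc p))
      = (x - real p) * divdiff f (insert (y + x) (unit_nodes y (Suc p)))"
    unfolding unit_nodes_Suc using Suc.prems by (subst divdiff_exchange) auto
  then show ?case
    using Suc by (simp add: newton_remainder_Suc right_diff_distrib[symmetric] mult.assoc)
qed

text \<open>
  The interpolation property. The node \<open>y + m\<close> is still new at stage \<open>p = m\<close>, so
  \<open>newton_remainder_eq_divdiff\<close> applies there and shows that the next Newton term cancels the
  error; every later term contains the factor \<open>x - m\<close>.
\<close>

lemma newton_remainder_at_node:
  assumes "m < p"
  shows "newton_remainder p f y (real m) = 0"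
  using assms
proof (induction p)
  case 0
  then show ?case by simp
next
  case (Suc p)
  show ?case
  proof (cases "m = p")
    case True
    then have "newton_remainder p f y (real m)
        = (\<Prod>i<p. real m - real i) * divdiff f (unit_nodes y (Suc p))"
      by (subst newton_remainder_eq_divdiff) (auto simp: unit_nodes_Suc)
    then show ?thesis
      by (simp add: newton_remainder_Suc)
  next
    case False
    then have "m < p" using Suc by simp
    then have "(\<Prod>i<p. real m - real i) = 0"
      by (intro prod_zero) auto
    then show ?thesis
      using Suc \<open>m < p\<close> by (simp add: newton_remainder_Suc)
  qed
qed

section \<open>Remainder bounds for convex functions\<close>

lemma prod_shift_le_power:
  assumes "0 < x" "x < real L" "p \<le> L"
  shows "\<bar>\<Prod>i<p. x - real i\<bar> \<le> real L ^ p"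
proof -
  have "(\<Prod>i<p. \<bar>x - real i\<bar>) \<le> (\<Prod>i<p. real L)"
    by (rule prod_mono) (use assms in auto)
  then show ?thesis
    by (simp add: abs_prod)
qed

text \<open>
  For \<open>x\<close> not a node, both errors are governed by the divided difference \<open>e\<close> at
  \<open>y, \<dots>, y + p - 1, y + x\<close>: the second involves \<open>e - d y\<close>. Moving the node \<open>y - 1\<close> to \<open>y + x\<close>, and
  then all nodes beyond \<open>y + L\<close>, gives \<open>d (y - 1) \<le> e \<le> d (y + L)\<close>, and \<open>d y\<close> lies between the same
  bounds. The bounds do not depend on \<open>x\<close>, which is what yields uniform convergence.
\<close>

lemma newton_remainder_bounds:
  fixes p L :: nat and g :: "real \<Rightarrow> real"
  defines "d \<equiv> \<lambda>z. divdiff g (unit_nodes z (Suc p))"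
  assumes conv: "p_convex_on (int p) {a..} g"
    and "a \<le> y - 1" "0 < x" "x < real L" "p < L"
  shows "\<bar>newton_remainder p g y x\<bar> \<le> real L ^ p * (\<bar>d (y - 1)\<bar> + \<bar>d (y + real L)\<bar>)"
    and "\<bar>newton_remainder (Suc p) g y x\<bar> \<le> real L ^ p * (d (y + real L) - d (y - 1))"
proof -
  let ?T = "unit_nodes y p" and ?Q = "\<Prod>i<p. x - real i"
  note mono = divdiff_mono_nodes[OF p_convex_on_divdiff_nonneg[OF conv]]
  have d_low: "d (y - 1) = divdiff g ({y - 1} \<union> ?T)"
    using unit_nodes_Suc_shift[of "y - 1" p] by (simp add: d_def)
  have d_mid: "d (y - 1) \<le> d y" "d y \<le> d (y + real L)"
  proof -
    have new: "y - 1 \<notin> ?T" "y + real p \<notin> ?T"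
      by (auto dest: unit_nodes_bounds)
    have "divdiff g ({y - 1} \<union> ?T) \<le> divdiff g ({y + real p} \<union> ?T)"
      by (rule mono) (use assms new in \<open>auto dest: unit_nodes_bounds\<close>)
    then show "d (y - 1) \<le> d y"
      by (simp add: d_low) (simp add: d_def unit_nodes_Suc)
    \<comment> \<open>Since \<open>p < L\<close>, the two blocks of nodes are separated and all nodes can be moved at once.\<close>
    have "divdiff g (unit_nodes y (Suc p) \<union> {})
        \<le> divdiff g (unit_nodes (y + real L) (Suc p) \<union> {})"
      by (rule mono) (use assms in \<open>auto dest!: unit_nodes_bounds\<close>)
    then show "d y \<le> d (y + real L)"
      by (simp add: d_def)
  qed
  have Q: "\<bar>?Q\<bar> \<le> real L ^ p"
    using assms by (intro prod_shift_le_power) auto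
  have bound: "\<bar>newton_remainder p g y x\<bar> \<le> real L ^ p * (\<bar>d (y - 1)\<bar> + \<bar>d (y + real L)\<bar>) \<and>
      \<bar>newton_remainder (Suc p) g y x\<bar> \<le> real L ^ p * (d (y + real L) - d (y - 1))"
  proof (cases "\<exists>i<p. x = real i")
    case True
    then have "newton_remainder p g y x = 0" "newton_remainder (Suc p) g y x = 0"
      by (auto intro: newton_remainder_at_node)
    then show ?thesis
      using d_mid by simp
  next
    case False
    define e where "e = divdiff g (insert (y + x) ?T)"
    have new': "y - 1 \<notin> ?T"
      by (auto dest: unit_nodes_bounds)
    have new: "y + x \<notin> ?T"
      using False by (auto simp: unit_nodes_def)
    have "divdiff g ({y - 1} \<union> ?T) \<le> divdiff g ({y + x} \<union> ?T)"
      by (rule mono) (use assms new new' in \<open>auto dest: unit_nodes_bounds\<close>)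
    then have e_low: "d (y - 1) \<le> e"
      by (simp add: d_low e_def)
    have "divdiff g (insert (y + x) ?T \<union> {})
        \<le> divdiff g (unit_nodes (y + real L) (Suc p) \<union> {})"
      by (rule mono) (use assms new in \<open>auto dest!: unit_nodes_bounds\<close>)
    then have e_up: "e \<le> d (y + real L)"
      by (simp add: d_def e_def)
    have rem: "newton_remainder p g y x = ?Q * e"
      using False by (simp add: newton_remainder_eq_divdiff e_def)
    then have rem': "newton_remainder (Suc p) g y x = ?Q * (e - d y)"
      by (simp add: newton_remainder_Suc d_def right_diff_distrib)
    have "\<bar>e\<bar> \<le> \<bar>d (y - 1)\<bar> + \<bar>d (y + real L)\<bar>" "\<bar>e - d y\<bar> \<le> d (y + real L) - d (y - 1)"
      using e_low e_up d_mid by linarith+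
    then show ?thesis
      unfolding rem rem' abs_mult using Q by (intro conjI mult_mono) auto
  qed
  show "\<bar>newton_remainder p g y x\<bar> \<le> real L ^ p * (\<bar>d (y - 1)\<bar> + \<bar>d (y + real L)\<bar>)"
    and "\<bar>newton_remainder (Suc p) g y x\<bar> \<le> real L ^ p * (d (y + real L) - d (y - 1))"
    using bound by blast+
qed

section \<open>Convergence of the defining sequences\<close>

lemma Dp_fdiff_power_tendsto_0:
  assumes "g \<in> Dp p" "p \<le> j"
  shows "(\<lambda>n. (fdiff ^^ j) g (real n)) \<longlonglongrightarrow> 0"
  using assms(2)
proof (induction j rule: dec_induct)
  case base
  then show ?case using assms(1) by (simp add: Dp_def)
next
  case (step j)
  have "(\<lambda>n. (fdiff ^^ j) g (real (Suc n)) - (fdiff ^^ j) g (real n)) \<longlonglongrightarrow> 0 - 0"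
    by (intro tendsto_diff LIMSEQ_Suc step.IH)
  then show ?case
    unfolding fdiff_power_Suc by (simp add: add.commute)
qed

text \<open>
  The binomial correction in \<open>Sigma_seq\<close> is chosen so that the increments in \<open>n\<close> are interpolation
  errors. At \<open>n = 0\<close> this fails, because the sum over \<open>k\<close> starts at \<open>1\<close>.
\<close>

lemma Sigma_seq_Suc:
  assumes "0 < n"
  shows "Sigma_seq p g x (Suc n) - Sigma_seq p g x n = - newton_remainder (Suc p) g (real n) x"
proof -
  have "{..<Suc p} = insert 0 {1..p}"
    by auto
  then have rem: "newton_remainder (Suc p) g (real n) x
      = g (real n + x) - g (real n) - (\<Sum>j=1..p. (x gchoose j) * (fdiff ^^ j) g (real n))"
    by (simp add: newton_remainder_def)
  have step: "(fdiff ^^ (j - 1)) g (real (Suc n)) - (fdiff ^^ (j - 1)) g (real n)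
      = (fdiff ^^ j) g (real n)" if "1 \<le> j" for j
    using that by (cases j) (simp_all add: fdiff_power_Suc add.commute del: funpow.simps)
  have "(\<Sum>j=1..p. (x gchoose j) * (fdiff ^^ (j - 1)) g (real (Suc n)))
      - (\<Sum>j=1..p. (x gchoose j) * (fdiff ^^ (j - 1)) g (real n))
      = (\<Sum>j=1..p. (x gchoose j) * (fdiff ^^ j) g (real n))"
    unfolding sum_subtractf[symmetric] right_diff_distrib[symmetric]
    by (intro sum.cong) (simp_all only: step atLeastAtMost_iff)
  then show ?thesis
    using assms by (simp add: Sigma_seq_def rem add.commute)
qed

text \<open>
  The sequence solves the difference equation up to an interpolation error: the sum telescopes,
  and Pascal's rule turns the binomial correction into the Newton polynomial.
\<close>

lemma Sigma_seq_shift: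
  assumes "0 < n"
  shows "Sigma_seq p g (x + 1) n - Sigma_seq p g x n = g x - newton_remainder p g (real n) x"
proof -
  have tele: "(\<Sum>k=1..<n. g (real k) - g (x + 1 + real k)) - (\<Sum>k=1..<n. g (real k) - g (x + real k))
      = g (x + 1) - g (x + real n)"
    using assms
  proof (induction n rule: nat_induct_non_zero)
    case 1
    then show ?case by simp
  next
    case (Suc n)
    then show ?case by (simp add: algebra_simps)
  qed
  have pascal: "((x + 1) gchoose j) - (x gchoose j) = x gchoose (j - 1)" if "1 \<le> j" for j
    using that gbinomial_Suc_Suc[of x "j - 1"] by simp
  have "(\<Sum>j=1..p. ((x + 1) gchoose j) * (fdiff ^^ (j - 1)) g (real n))
      - (\<Sum>j=1..p. (x gchoose j) * (fdiff ^^ (j - 1)) g (real n))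
      = (\<Sum>j=1..p. (x gchoose (j - 1)) * (fdiff ^^ (j - 1)) g (real n))"
    unfolding sum_subtractf[symmetric] left_diff_distrib[symmetric]
    by (intro sum.cong) (simp_all only: pascal atLeastAtMost_iff)
  also have "\<dots> = (\<Sum>j<p. (x gchoose j) * (fdiff ^^ j) g (real n))"
    by (rule sum.reindex_bij_witness[of _ Suc "\<lambda>j. j - 1"]) auto
  finally show ?thesis
    using tele by (simp add: Sigma_seq_def newton_remainder_def add.commute)
qed

lemma uminus_fdiff_power: "(fdiff ^^ j) (\<lambda>t. - g t) y = - (fdiff ^^ j) g y"
  by (simp add: fdiff_power_eq_divdiff divdiff_def sum_negf)

lemma Sigma_seq_uminus: "Sigma_seq p (\<lambda>t. - g t) x n = - Sigma_seq p g x n"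
  by (simp add: Sigma_seq_def uminus_fdiff_power sum_subtractf sum_negf)

lemma newton_remainder_uminus:
  "newton_remainder p (\<lambda>t. - g t) y x = - newton_remainder p g y x"
  by (simp add: newton_remainder_def uminus_fdiff_power sum_negf)

lemma p_convex_on_uminus: "p_convex_on p I (\<lambda>t. - g t) \<longleftrightarrow> p_concave_on p I g"
  by (simp add: p_convex_on_def p_concave_on_def divided_difference_def sum_negf)

text \<open>
  A difference over \<open>L + 1\<close> consecutive indices is a sum of \<open>L + 1\<close> telescoping series. The
  truncated value of \<open>n - 1\<close> at \<open>n = 0\<close> affects only one term.
\<close>

lemma summable_long_step_differences:
  fixes d :: "nat \<Rightarrow> real"
  assumes "d \<longlonglongrightarrow> c"
  shows "summable (\<lambda>n. d (n + L) - d (n - 1))"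
proof -
  have "summable (\<lambda>n. \<Sum>i<Suc L. d (Suc n + i) - d (n + i))"
    using assms by (intro summable_sum telescope_summable[of "\<lambda>n. d (n + _)"] LIMSEQ_ignore_initial_segment)
  moreover have "(\<Sum>i<Suc L. d (Suc n + i) - d (n + i)) = d (Suc n + L) - d n" for n
    using sum_lessThan_telescope[of "\<lambda>i. d (n + i)" "Suc L"] by (simp del: sum.lessThan_Suc)
  ultimately have "summable (\<lambda>n. d (Suc n + L) - d (Suc n - 1))"
    by (simp del: sum.lessThan_Suc)
  then show ?thesis
    using summable_Suc_iff[of "\<lambda>n. d (n + L) - d (n - 1)"] by blast
qed

lemma Sigma_seq_convergence_convex:
  assumes "g \<in> Dp p" "p_convex_on (int p) {a..} g"
  shows "uniformly_convergent_on {0<..<real L} (\<lambda>n x. Sigma_seq p g x n)"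
    and "0 < x \<Longrightarrow> (\<lambda>n. newton_remainder p g (real n) x) \<longlonglongrightarrow> 0"
proof -
  define d where "d n = divdiff g (unit_nodes (real n) (Suc p))" for n :: nat
  have "(\<lambda>n. (fdiff ^^ p) g (real n) / fact p) \<longlonglongrightarrow> 0 / fact p"
    using assms(1) unfolding Dp_def by (intro tendsto_divide) auto
  then have d0: "d \<longlonglongrightarrow> 0"
    by (simp add: fdiff_power_eq_divdiff d_def[abs_def])
  have bounds: "\<forall>\<^sub>F n in sequentially. 0 < n \<and> (\<forall>x\<in>{0<..<real K}.
      \<bar>newton_remainder p g (real n) x\<bar> \<le> real K ^ p * (\<bar>d (n - 1)\<bar> + \<bar>d (n + K)\<bar>) \<and>
      \<bar>newton_remainder (Suc p) g (real n) x\<bar> \<le> real K ^ p * (d (n + K) - d (n - 1)))"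
    if "p < K" for K
  proof -
    have "\<forall>\<^sub>F n in sequentially. 0 < n \<and> a + 1 \<le> real n"
      using eventually_gt_at_top[of 0] eventually_ge_at_top[of "nat \<lceil>a + 1\<rceil>"]
      by eventually_elim linarith
    then show ?thesis
    proof eventually_elim
      case (elim n)
      then have "real (n - 1) = real n - 1"
        by simp
      then show ?case
        using elim newton_remainder_bounds[OF assms(2), of "real n" _ K] that
        by (simp add: d_def)
    qed
  qed
  \<comment> \<open>The bounds need \<open>K > p\<close>; enlarging the interval only strengthens the claim.\<close>
  define K where "K = max L (Suc p)"
  have K: "p < K" "{0<..<real L} \<subseteq> {0<..<real K}"
    by (auto simp: K_def)
  have "uniformly_convergent_on {0<..<real K}
      (\<lambda>n x. \<Sum>i<n. Sigma_seq p g x (Suc i) - Sigma_seq p g x i)"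
  proof (rule Weierstrass_m_test'_ev)
    show "\<forall>\<^sub>F n in sequentially. \<forall>x\<in>{0<..<real K}.
        norm (Sigma_seq p g x (Suc n) - Sigma_seq p g x n) \<le> real K ^ p * (d (n + K) - d (n - 1))"
      using bounds[OF K(1)] by eventually_elim (simp add: Sigma_seq_Suc)
    show "summable (\<lambda>n. real K ^ p * (d (n + K) - d (n - 1)))"
      by (intro summable_mult summable_long_step_differences[OF d0])
  qed
  then have "uniformly_convergent_on {0<..<real K}
      (\<lambda>n x. Sigma_seq p g x n - Sigma_seq p g x 0)"
    by (simp add: sum_lessThan_telescope)
  then have "uniformly_convergent_on {0<..<real K}
      (\<lambda>n x. (Sigma_seq p g x n - Sigma_seq p g x 0) + Sigma_seq p g x 0)"
    by (intro uniformly_convergent_add uniformly_convergent_on_const)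
  then show "uniformly_convergent_on {0<..<real L} (\<lambda>n x. Sigma_seq p g x n)"
    using K(2) by (auto intro: uniformly_convergent_on_subset)
  show "(\<lambda>n. newton_remainder p g (real n) x) \<longlonglongrightarrow> 0" if "0 < x"
  proof -
    obtain N :: nat where N: "x < real N"
      using reals_Archimedean2 by blast
    define K where "K = max N (Suc p)"
    have K: "p < K" "x \<in> {0<..<real K}"
      using N that by (auto simp: K_def)
    show ?thesis
    proof (rule Lim_null_comparison)
      show "\<forall>\<^sub>F n in sequentially. norm (newton_remainder p g (real n) x)
          \<le> real K ^ p * (\<bar>d (n - 1)\<bar> + \<bar>d (n + K)\<bar>)"
        using bounds[OF K(1)] by eventually_elim (use K(2) in auto)
      have "(\<lambda>n. d (n - 1)) \<longlonglongrightarrow> 0"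
        by (rule LIMSEQ_offset[of _ 1]) (simp add: d0)
      then have "(\<lambda>n. real K ^ p * (\<bar>d (n - 1)\<bar> + \<bar>d (n + K)\<bar>)) \<longlonglongrightarrow> real K ^ p * (\<bar>0\<bar> + \<bar>0\<bar>)"
        by (intro tendsto_intros LIMSEQ_ignore_initial_segment d0)
      then show "(\<lambda>n. real K ^ p * (\<bar>d (n - 1)\<bar> + \<bar>d (n + K)\<bar>)) \<longlonglongrightarrow> 0"
        by simp
    qed
  qed
qed

lemma Sigma_seq_convergence:
  assumes "g \<in> Dp p \<inter> Kp (int p)"
  shows "uniformly_convergent_on {0<..<real L} (\<lambda>n x. Sigma_seq p g x n)"
    and "0 < x \<Longrightarrow> (\<lambda>n. newton_remainder p g (real n) x) \<longlonglongrightarrow> 0"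
proof -
  have "uniformly_convergent_on {0<..<real L} (\<lambda>n x. Sigma_seq p g x n) \<and>
    (0 < x \<longrightarrow> (\<lambda>n. newton_remainder p g (real n) x) \<longlonglongrightarrow> 0)"
  proof (cases "\<exists>a. p_convex_on (int p) {a..} g")
    case True
    then show ?thesis
      using assms Sigma_seq_convergence_convex by blast
  next
    case False
    then obtain a where a: "p_convex_on (int p) {a..} (\<lambda>t. - g t)"
      using assms by (auto simp: Kp_def p_convex_on_uminus)
    have "(\<lambda>t. - g t) \<in> Dp p"
      using assms tendsto_minus[of "\<lambda>n. (fdiff ^^ p) g (real n)" 0 sequentially]
      by (simp add: Dp_def uminus_fdiff_power)
    note conv = Sigma_seq_convergence_convex[OF this a]
    have "uniformly_convergent_on {0<..<real L} (\<lambda>n x. - Sigma_seq p (\<lambda>t. - g t) x n)"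
      using uniformly_convergent_mult[OF conv(1), of L "-1"] by simp
    moreover have "(\<lambda>n. - newton_remainder p (\<lambda>t. - g t) (real n) x) \<longlonglongrightarrow> - 0" if "0 < x"
      by (rule tendsto_minus[OF conv(2)[OF that]])
    ultimately show ?thesis
      by (simp add: Sigma_seq_uminus newton_remainder_uminus)
  qed
  then show "uniformly_convergent_on {0<..<real L} (\<lambda>n x. Sigma_seq p g x n)"
    and "0 < x \<Longrightarrow> (\<lambda>n. newton_remainder p g (real n) x) \<longlonglongrightarrow> 0"
    by blast+
qed

section \<open>The operator as a continuous solution of the difference equation\<close>

text \<open>
  The description of \<open>Sigma_op\<close> is meaningful only if all admissible orders give the same limit.
  For \<open>r \<le> q\<close> the sequences of orders \<open>q\<close> and \<open>r\<close> differ by terms containing \<open>\<Delta>\<^sup>jg(n)\<close> with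
  \<open>j \<ge> r\<close>, all of which tend to \<open>0\<close> as soon as \<open>\<Delta>\<^sup>rg(n)\<close> does.
\<close>

lemma Sigma_seq_tendsto_Sigma_op:
  assumes "g \<in> Dp p \<inter> Kp (int p)" "0 < x"
  shows "Sigma_seq p g x \<longlonglongrightarrow> Sigma_op g x"
proof -
  obtain L :: nat where "x \<in> {0<..<real L}"
    using assms(2) reals_Archimedean2[of x] by auto
  then have "convergent (Sigma_seq p g x)"
    using uniformly_convergent_imp_convergent[OF Sigma_seq_convergence(1)[OF assms(1)]] by blast
  then obtain l where l: "Sigma_seq p g x \<longlonglongrightarrow> l"
    by (auto simp: convergent_def)
  have raise: "(\<lambda>n. Sigma_seq q g x n - Sigma_seq r g x n) \<longlonglongrightarrow> 0" if "g \<in> Dp r" "r \<le> q" for q r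
  proof -
    have "{1..q} = {1..r} \<union> {Suc r..q}"
      using that(2) by auto
    then have "Sigma_seq q g x n - Sigma_seq r g x n
        = (\<Sum>j=Suc r..q. (x gchoose j) * (fdiff ^^ (j - 1)) g (real n))" for n
      by (simp add: Sigma_seq_def sum.union_disjoint)
    moreover have "(\<lambda>n. \<Sum>j=Suc r..q. (x gchoose j) * (fdiff ^^ (j - 1)) g (real n)) \<longlonglongrightarrow> 0"
      using that(1) by (intro tendsto_null_sum tendsto_mult_right_zero Dp_fdiff_power_tendsto_0) auto
    ultimately show ?thesis
      by simp
  qed
  have all: "Sigma_seq q g x \<longlonglongrightarrow> l" if "g \<in> Dp q \<inter> Kp (int q)" for q
  proof -
    have "(\<lambda>n. Sigma_seq q g x n - Sigma_seq p g x n) \<longlonglongrightarrow> 0"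
    proof (cases "p \<le> q")
      case True
      then show ?thesis
        using raise[of p q] assms(1) by simp
    next
      case False
      then show ?thesis
        using tendsto_minus[OF raise[of q p]] that by simp
    qed
    from tendsto_add[OF this l] show ?thesis
      by simp
  qed
  then have "Sigma_op g x = l"
    unfolding Sigma_op_def using assms(1) by (intro the_equality) (auto intro: LIMSEQ_unique)
  then show ?thesis
    using l by simp
qed

lemma Sigma_op_difference_equation:
  assumes "g \<in> dom_Sigma" "0 < x"
  shows "Sigma_op g (x + 1) - Sigma_op g x = g x"
proof -
  obtain p where p: "g \<in> Dp p \<inter> Kp (int p)"
    using assms(1) by (auto simp: dom_Sigma_def)
  have "(\<lambda>n. Sigma_seq p g (x + 1) n - Sigma_seq p g x n)
      \<longlonglongrightarrow> Sigma_op g (x + 1) - Sigma_op g x"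
    using assms(2) by (intro tendsto_diff Sigma_seq_tendsto_Sigma_op p) auto
  moreover have "(\<lambda>n. Sigma_seq p g (x + 1) n - Sigma_seq p g x n) \<longlonglongrightarrow> g x - 0"
  proof (rule Lim_transform_eventually)
    show "(\<lambda>n. g x - newton_remainder p g (real n) x) \<longlonglongrightarrow> g x - 0"
      using Sigma_seq_convergence(2)[OF p assms(2)] by (intro tendsto_intros)
    show "\<forall>\<^sub>F n in sequentially. g x - newton_remainder p g (real n) x
        = Sigma_seq p g (x + 1) n - Sigma_seq p g x n"
      using eventually_gt_at_top[of 0] by eventually_elim (simp add: Sigma_seq_shift)
  qed
  ultimately show ?thesis
    using LIMSEQ_unique by fastforce
qed

lemma continuous_on_Sigma_op:
  assumes "g \<in> C0 \<inter> dom_Sigma"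
  shows "continuous_on {0<..} (Sigma_op g)"
proof -
  obtain p where p: "g \<in> Dp p \<inter> Kp (int p)"
    using assms by (auto simp: dom_Sigma_def)
  have cont_seq: "continuous_on {0<..<real L} (\<lambda>x. Sigma_seq p g x n)" for L n
  proof -
    have g: "continuous_on {0<..} g"
      using assms by (simp add: C0_def)
    have "continuous_on {0<..<real L} (\<lambda>x. g (x + real k))" for k
      by (rule continuous_on_compose2[OF g]) (auto intro!: continuous_intros)
    from this this[of 0] show ?thesis
      unfolding Sigma_seq_def gbinomial_prod_rev by (auto intro!: continuous_intros)
  qed
  have "continuous_on {0<..<real L} (Sigma_op g)" for L
  proof -
    obtain l where l: "uniform_limit {0<..<real L} (\<lambda>n x. Sigma_seq p g x n) l sequentially"
      using Sigma_seq_convergence(1)[OF p] by (auto simp: uniformly_convergent_on_def)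
    have "continuous_on {0<..<real L} l"
      by (rule uniform_limit_theorem[OF _ l]) (simp_all add: cont_seq)
    moreover have "l x = Sigma_op g x" if "x \<in> {0<..<real L}" for x
      using tendsto_uniform_limitI[OF l that] Sigma_seq_tendsto_Sigma_op[OF p] that
      by (auto intro: LIMSEQ_unique)
    ultimately show ?thesis
      using continuous_on_cong[of "{0<..<real L}" _ l "Sigma_op g"] by blast
  qed
  moreover have "\<exists>L::nat. x \<in> {0<..<real L}" if "0 < x" for x
    using that reals_Archimedean2[of x] by auto
  ultimately have "isCont (Sigma_op g) x" if "0 < x" for x
    using that by (metis continuous_on_eq_continuous_at open_greaterThanLessThan)
  then show ?thesis
    by (simp add: continuous_at_imp_continuous_on)
qed

section \<open>Integration over a unit interval\<close>

lemma interval_integral_FTC_positive: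
  fixes f F :: "real \<Rightarrow> real"
  assumes "continuous_on {0<..} f" "\<And>t. 0 < t \<Longrightarrow> (F has_vector_derivative f t) (at t)"
    and "0 < a" "0 < b"
  shows "(LBINT t=a..b. f t) = F b - F a"
proof (rule interval_integral_FTC_finite)
  have "{min a b..max a b} \<subseteq> {0<..}"
    using assms(3,4) by auto
  then show "continuous_on {min a b..max a b} f"
    using assms(1) continuous_on_subset by blast
  show "(F has_vector_derivative f t) (at t within {min a b..max a b})"
    if "min a b \<le> t" "t \<le> max a b" for t
    by (rule has_vector_derivative_at_within, rule assms(2)) (use assms(3,4) that in auto)
qed

theorem proposition8p18:
  fixes g :: "real \<Rightarrow> real" and x :: real
  assumes "g \<in> C0 \<inter> dom_Sigma"
    and "x > 0"
  shows "(LBINT t=x..x + 1. Sigma_op g t) = asymptotic_constant g + (LBINT t=1..x. g t)"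
proof -
  let ?S = "Sigma_op g"
  have contS: "continuous_on {0<..} ?S" and contg: "continuous_on {0<..} g"
    using assms(1) by (auto simp: C0_def intro: continuous_on_Sigma_op)
  have "\<exists>P. \<forall>t. ereal 0 < ereal t \<longrightarrow> ereal t < \<infinity> \<longrightarrow> (P has_vector_derivative ?S t) (at t)"
    using contS by (intro einterval_antiderivative) (auto simp: continuous_on_eq_continuous_at)
  then obtain P where P: "(P has_vector_derivative ?S t) (at t)" if "0 < t" for t
    by auto
  have P_shift: "((\<lambda>t. P (t + 1)) has_vector_derivative ?S (t + 1)) (at t)" if "-1 < t" for t
  proof -
    have "((\<lambda>t. t + 1) has_vector_derivative 1) (at t)"
      by (auto intro!: derivative_eq_intros)
    from vector_diff_chain_at[OF this P] show ?thesis
      using that by (simp add: o_def)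
  qed
  have "(LBINT t=x..x + 1. ?S t) = P (x + 1) - P x"
    using interval_integral_FTC_positive[OF contS P, of x "x + 1"] assms(2) by simp
  moreover have "asymptotic_constant g = P 2 - P 1"
  proof -
    have "(LBINT t=ereal 0..ereal 1. ?S (t + 1)) = P (1 + 1) - P (0 + 1)"
    proof (rule interval_integral_FTC_finite)
      show "continuous_on {min 0 1..max 0 1} (\<lambda>t. ?S (t + 1))"
        by (rule continuous_on_compose2[OF contS]) (auto intro!: continuous_intros)
    qed (rule has_vector_derivative_at_within, rule P_shift, simp)
    then show ?thesis
      by (simp add: asymptotic_constant_def zero_ereal_def one_ereal_def)
  qed
  moreover have "(LBINT t=1..x. g t) = (P (x + 1) - P x) - (P (1 + 1) - P 1)"
  proof -
    have "((\<lambda>t. P (t + 1) - P t) has_vector_derivative g t) (at t)" if "0 < t" for t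
      using has_vector_derivative_diff[OF P_shift P, of t] that assms(1)
        Sigma_op_difference_equation[of g t] by simp
    from interval_integral_FTC_positive[OF contg this, of 1 x] show ?thesis
      using assms(2) by (simp add: one_ereal_def)
  qed
  ultimately show ?thesis
    by simp
qed

end
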